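(* Let $G=(\mathcal V,\mathcal C,\mathcal E)$ be an induced Tanner subgraph with syndrome vector $\boldsymbol{s}=(s_c)_{c\in\mathcal C}$, viewed as the check-node labeling $\chi_C(c)=s_c$. Consider a flooding-schedule syndrome-based iterative decoder on $G$ under the isolation assumption (all as defined in the context). Let $\psi\in\operatorname{Aut}(G,\chi_C)$, and assume that the initial variable-to-check messages and all boundary messages are invariant under $\psi$, that is, $\nu^{(0)}_{v\to c}=\nu^{(0)}_{\psi(v)\to\psi(c)}$ for all $(v,c)\in\mathcal E$, and $b^{(\ell)}_u=b^{(\ell)}_{\psi(u)}$ for every node $u\in\mathcal V\sqcup\mathcal C$ and every $\ell\ge 0$. (1) If the decoder is isotropic, then for every iteration $\ell\ge 0$ and every edge $(v,c)\in\mathcal E$, $$\nu^{(\ell)}_{v\to c}=\nu^{(\ell)}_{\psi(v)\to\psi(c)},\qquad \mu^{(\ell)}_{c\to v}=\mu^{(\ell)}_{\psi(c)\to\psi(v)},$$ and for every $\ell\ge 0$ and every variable node $v\in\mathcal V$, $$\nu^{(\ell)}_{v}=\nu^{(\ell)}_{\psi(v)}.$$ (2) If the decoder is anisotropic (variable-anisotropic or edge-anisotropic) with decoder labeling $\chi$, defined either on $\mathcal V$ or on $\mathcal E$, and if in addition $\psi\in\operatorname{Aut}(G,\chi_C,\chi)$, then the same conclusion holds. Hence the message evolution and the tentative decisions are equivariant under every automorphism preserved by the decoder.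
   Context: A Tanner graph $G=(\mathcal V,\mathcal C,\mathcal E)$ is a finite bipartite graph with variable nodes $\mathcal V$, check nodes $\mathcal C$ and edges $(v,c)\in\mathcal E\subseteq\mathcal V\times\mathcal C$. $\mathcal M(v)$ is the set of checks adjacent to $v$; $\mathcal N(c)$ is the set of variables adjacent to $c$. **Automorphisms.** A type-preserving automorphism of $G$ is a bijection $\psi:\mathcal V\sqcup\mathcal C\to\mathcal V\sqcup\mathcal C$ with $\psi(\mathcal V)=\mathcal V$, $\psi(\mathcal C)=\mathcal C$, and $(v,c)\in\mathcal E$ if and only if $(\psi(v),\psi(c))\in\mathcal E$. These form the group $\operatorname{Aut}(G)$. Given labelings of $\mathcal V$, $\mathcal C$ and/or $\mathcal E$, $\psi$ preserves a labeling $\chi$ if $\chi(\psi(z))=\chi(z)$ for all $z$ in its domain, where $\psi(v,c)=(\psi(v),\psi(c))$ on edges. $\operatorname{Aut}(G,\chi_1,\chi_2,\dots)$ is the subgroup of $\operatorname{Aut}(G)$ preserving all listed labelings. **Isolation assumption and boundary messages.** All nodes outside $G$ are regarded as having converged and are excluded from the updates, so the updates use only messages inside $G$, together with possible boundary messages: each node $u\in\mathcal V\sqcup\mathcal C$ may receive at iteration $\ell$ a finite multiset $b^{(\ell)}_u$ (possibly empty) of messages from outside $G$, which is adjoined to the multiset of incoming messages used in every update at $u$. **Isotropic decoder.** There are functions $\Phi$, $\Psi$, each taking a scalar and a finite multiset of messages (hence permutation invariant), independent of the node and of the iteration, and a scalar prior $\lambda$ common to all variable nodes. Variable-to-check messages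 $\nu^{(0)}_{v\to c}$ are given initially, and (boundary messages being adjoined to the multisets) $$\nu^{(\ell)}_{v\to c}=\Phi\big(\lambda,\{\mu^{(\ell-1)}_{c'\to v}:c'\in\mathcal M(v)\setminus\{c\}\}\big)\quad(\ell\ge1),$$ $$\mu^{(\ell)}_{c\to v}=\Psi\big(s_c,\{\nu^{(\ell)}_{v'\to c}:v'\in\mathcal N(c)\setminus\{v\}\}\big)\quad(\ell\ge0),$$ $$\nu^{(\ell)}_v=\Phi\big(\lambda,\{\mu^{(\ell)}_{c\to v}:c\in\mathcal M(v)\}\big)\quad(\ell\ge0).$$ Here $\nu^{(\ell)}_v$ is the tentative decision at $v$, and the sets of messages are multisets. **Anisotropic decoders.** A family $\Phi^{(1)},\dots,\Phi^{(K)}$ of variable-node rules of the same kind as $\Phi$ (permutation invariant and iteration independent) is given, and the check rule $\Psi$ is shared by all checks, so that $\mu^{(\ell)}_{c\to v}=\Psi\big(s_c,\{\nu^{(\ell)}_{v'\to c}:v'\in\mathcal N(c)\setminus\{v\}\}\big)$ for $\ell\ge0$ (in all these formulas the sets of messages are multisets, to which boundary messages are adjoined). The decoder is variable-anisotropic if there is a labeling $\chi=\chi_V:\mathcal V\to\{1,\dots,K\}$ such that all outgoing messages of $v$ (and the tentative decision at $v$) are computed with the rule $\Phi^{(\chi_V(v))}$, that is, $\nu^{(\ell)}_{v\to c}=\Phi^{(\chi_V(v))}\big(\lambda,\{\mu^{(\ell-1)}_{c'\to v}:c'\in\mathcal M(v)\setminus\{c\}\}\big)$ for $\ell\ge1$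 and $\nu^{(\ell)}_v=\Phi^{(\chi_V(v))}\big(\lambda,\{\mu^{(\ell)}_{c\to v}:c\in\mathcal M(v)\}\big)$ for $\ell\ge0$. It is edge-anisotropic if there is a labeling $\chi=\chi_E:\mathcal E\to\{1,\dots,K\}$ such that $\nu^{(\ell)}_{v\to c}$ is computed with $\Phi^{(\chi_E(v,c))}$, that is, $\nu^{(\ell)}_{v\to c}=\Phi^{(\chi_E(v,c))}\big(\lambda,\{\mu^{(\ell-1)}_{c'\to v}:c'\in\mathcal M(v)\setminus\{c\}\}\big)$ for $\ell\ge1$; in this case the tentative decisions are computed with one permutation-invariant rule common to all variable nodes. *)

theory Defs
  imports "HOL-Library.Multiset" "HOL-Library.FuncSet"
begin

text \<open>Variable and check nodes live in one type of nodes; the disjoint union of the two node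
  sets is rendered as the union of two disjoint sets.\<close>

record 'n tanner =
  vnodes :: "'n set"
  cnodes :: "'n set"
  edges :: "('n \<times> 'n) set"

definition tanner_graph :: "'n tanner \<Rightarrow> bool" where
  "tanner_graph G \<longleftrightarrow>
     finite (vnodes G) \<and> finite (cnodes G) \<and> vnodes G \<inter> cnodes G = {} \<and>
     edges G \<subseteq> vnodes G \<times> cnodes G"

definition induced_tanner_subgraph :: "'n tanner \<Rightarrow> 'n tanner \<Rightarrow> bool" where
  "induced_tanner_subgraph G H \<longleftrightarrow>
     vnodes G \<subseteq> vnodes H \<and> cnodes G \<subseteq> cnodes H \<and>
     edges G = edges H \<inter> (vnodes G \<times> cnodes G)"

definition checks_of :: "'n tanner \<Rightarrow> 'n \<Rightarrow> 'n set" where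
  "checks_of G v = {c. (v, c) \<in> edges G}"

definition vars_of :: "'n tanner \<Rightarrow> 'n \<Rightarrow> 'n set" where
  "vars_of G c = {v. (v, c) \<in> edges G}"

text \<open>Automorphisms are total functions; only their values on the nodes of the graph matter.\<close>

definition Aut :: "'n tanner \<Rightarrow> ('n \<Rightarrow> 'n) set" where
  "Aut G = {\<psi>. bij_betw \<psi> (vnodes G \<union> cnodes G) (vnodes G \<union> cnodes G) \<and>
     \<psi> ` vnodes G = vnodes G \<and> \<psi> ` cnodes G = cnodes G \<and>
     (\<forall>v\<in>vnodes G. \<forall>c\<in>cnodes G. (v, c) \<in> edges G \<longleftrightarrow> (\<psi> v, \<psi> c) \<in> edges G)}"

definition preserves :: "('z \<Rightarrow> 'z) \<Rightarrow> 'z set \<Rightarrow> ('z \<Rightarrow> 'l) \<Rightarrow> bool" where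
  "preserves f D \<chi> \<longleftrightarrow> (\<forall>z\<in>D. \<chi> (f z) = \<chi> z)"

definition Aut_C :: "'n tanner \<Rightarrow> ('n \<Rightarrow> 's) \<Rightarrow> ('n \<Rightarrow> 'n) set" where
  "Aut_C G \<chi>C = {\<psi> \<in> Aut G. preserves \<psi> (cnodes G) \<chi>C}"

definition Aut_CV :: "'n tanner \<Rightarrow> ('n \<Rightarrow> 's) \<Rightarrow> ('n \<Rightarrow> 'l) \<Rightarrow> ('n \<Rightarrow> 'n) set" where
  "Aut_CV G \<chi>C \<chi>V =
     {\<psi> \<in> Aut G. preserves \<psi> (cnodes G) \<chi>C \<and> preserves \<psi> (vnodes G) \<chi>V}"

definition Aut_CE :: "'n tanner \<Rightarrow> ('n \<Rightarrow> 's) \<Rightarrow> ('n \<times> 'n \<Rightarrow> 'l) \<Rightarrow> ('n \<Rightarrow> 'n) set" where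
  "Aut_CE G \<chi>C \<chi>E =
     {\<psi> \<in> Aut G. preserves \<psi> (cnodes G) \<chi>C \<and> preserves (map_prod \<psi> \<psi>) (edges G) \<chi>E}"

text \<open>
  \<open>\<nu> l v c\<close> and \<open>\<mu> l c v\<close> are the messages along the edge \<open>(v, c)\<close> at iteration \<open>l\<close>,
  \<open>\<delta> l v\<close> is the tentative decision at \<open>v\<close>, and \<open>b l u\<close> is the multiset of boundary messages
  used in every update at \<open>u\<close> at iteration \<open>l\<close>, that is, in those with a result of index \<open>l\<close>.
  Priors, syndrome entries and messages have arbitrary types \<open>'p\<close>, \<open>'s\<close>, \<open>'m\<close>.
  The messages \<open>\<nu> 0\<close> are unconstrained: they are the initial data.
\<close>

type_synonym ('a, 'm) rule = "'a \<Rightarrow> 'm multiset \<Rightarrow> 'm"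

definition var_updates ::
  "'n tanner \<Rightarrow> ('n \<Rightarrow> 'n \<Rightarrow> ('p, 'm) rule) \<Rightarrow> 'p \<Rightarrow> (nat \<Rightarrow> 'n \<Rightarrow> 'm multiset) \<Rightarrow>
   (nat \<Rightarrow> 'n \<Rightarrow> 'n \<Rightarrow> 'm) \<Rightarrow> (nat \<Rightarrow> 'n \<Rightarrow> 'n \<Rightarrow> 'm) \<Rightarrow> bool" where
  "var_updates G R lam b \<nu> \<mu> \<longleftrightarrow>
     (\<forall>l\<ge>1. \<forall>(v, c)\<in>edges G.
        \<nu> l v c = R v c lam
          (image_mset (\<lambda>c'. \<mu> (l - 1) c' v) (mset_set (checks_of G v - {c})) + b l v))"

definition check_updates ::
  "'n tanner \<Rightarrow> ('s, 'm) rule \<Rightarrow> ('n \<Rightarrow> 's) \<Rightarrow> (nat \<Rightarrow> 'n \<Rightarrow> 'm multiset) \<Rightarrow>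
   (nat \<Rightarrow> 'n \<Rightarrow> 'n \<Rightarrow> 'm) \<Rightarrow> (nat \<Rightarrow> 'n \<Rightarrow> 'n \<Rightarrow> 'm) \<Rightarrow> bool" where
  "check_updates G \<Psi> s b \<nu> \<mu> \<longleftrightarrow>
     (\<forall>l. \<forall>(v, c)\<in>edges G.
        \<mu> l c v = \<Psi> (s c)
          (image_mset (\<lambda>v'. \<nu> l v' c) (mset_set (vars_of G c - {v})) + b l c))"

definition decisions ::
  "'n tanner \<Rightarrow> ('n \<Rightarrow> ('p, 'm) rule) \<Rightarrow> 'p \<Rightarrow> (nat \<Rightarrow> 'n \<Rightarrow> 'm multiset) \<Rightarrow>
   (nat \<Rightarrow> 'n \<Rightarrow> 'n \<Rightarrow> 'm) \<Rightarrow> (nat \<Rightarrow> 'n \<Rightarrow> 'm) \<Rightarrow> bool" where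
  "decisions G D lam b \<mu> \<delta> \<longleftrightarrow>
     (\<forall>l. \<forall>v\<in>vnodes G.
        \<delta> l v = D v lam (image_mset (\<lambda>c. \<mu> l c v) (mset_set (checks_of G v)) + b l v))"

definition isotropic_decoder ::
  "'n tanner \<Rightarrow> ('p, 'm) rule \<Rightarrow> ('s, 'm) rule \<Rightarrow> 'p \<Rightarrow> ('n \<Rightarrow> 's) \<Rightarrow>
   (nat \<Rightarrow> 'n \<Rightarrow> 'm multiset) \<Rightarrow> (nat \<Rightarrow> 'n \<Rightarrow> 'n \<Rightarrow> 'm) \<Rightarrow> (nat \<Rightarrow> 'n \<Rightarrow> 'n \<Rightarrow> 'm) \<Rightarrow>
   (nat \<Rightarrow> 'n \<Rightarrow> 'm) \<Rightarrow> bool" where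
  "isotropic_decoder G \<Phi> \<Psi> lam s b \<nu> \<mu> \<delta> \<longleftrightarrow>
     var_updates G (\<lambda>v c. \<Phi>) lam b \<nu> \<mu> \<and>
     check_updates G \<Psi> s b \<nu> \<mu> \<and>
     decisions G (\<lambda>v. \<Phi>) lam b \<mu> \<delta>"

definition variable_anisotropic_decoder ::
  "'n tanner \<Rightarrow> nat \<Rightarrow> ('n \<Rightarrow> nat) \<Rightarrow> (nat \<Rightarrow> ('p, 'm) rule) \<Rightarrow> ('s, 'm) rule \<Rightarrow> 'p \<Rightarrow>
   ('n \<Rightarrow> 's) \<Rightarrow> (nat \<Rightarrow> 'n \<Rightarrow> 'm multiset) \<Rightarrow> (nat \<Rightarrow> 'n \<Rightarrow> 'n \<Rightarrow> 'm) \<Rightarrow>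
   (nat \<Rightarrow> 'n \<Rightarrow> 'n \<Rightarrow> 'm) \<Rightarrow> (nat \<Rightarrow> 'n \<Rightarrow> 'm) \<Rightarrow> bool" where
  "variable_anisotropic_decoder G K \<chi> \<Phi>s \<Psi> lam s b \<nu> \<mu> \<delta> \<longleftrightarrow>
     \<chi> \<in> vnodes G \<rightarrow> {1..K} \<and>
     var_updates G (\<lambda>v c. \<Phi>s (\<chi> v)) lam b \<nu> \<mu> \<and>
     check_updates G \<Psi> s b \<nu> \<mu> \<and>
     decisions G (\<lambda>v. \<Phi>s (\<chi> v)) lam b \<mu> \<delta>"

definition edge_anisotropic_decoder ::
  "'n tanner \<Rightarrow> nat \<Rightarrow> ('n \<times> 'n \<Rightarrow> nat) \<Rightarrow> (nat \<Rightarrow> ('p, 'm) rule) \<Rightarrow> ('p, 'm) rule \<Rightarrow>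
   ('s, 'm) rule \<Rightarrow> 'p \<Rightarrow> ('n \<Rightarrow> 's) \<Rightarrow> (nat \<Rightarrow> 'n \<Rightarrow> 'm multiset) \<Rightarrow>
   (nat \<Rightarrow> 'n \<Rightarrow> 'n \<Rightarrow> 'm) \<Rightarrow> (nat \<Rightarrow> 'n \<Rightarrow> 'n \<Rightarrow> 'm) \<Rightarrow> (nat \<Rightarrow> 'n \<Rightarrow> 'm) \<Rightarrow> bool" where
  "edge_anisotropic_decoder G K \<chi> \<Phi>s \<Phi>dec \<Psi> lam s b \<nu> \<mu> \<delta> \<longleftrightarrow>
     \<chi> \<in> edges G \<rightarrow> {1..K} \<and>
     var_updates G (\<lambda>v c. \<Phi>s (\<chi> (v, c))) lam b \<nu> \<mu> \<and>
     check_updates G \<Psi> s b \<nu> \<mu> \<and>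
     decisions G (\<lambda>v. \<Phi>dec) lam b \<mu> \<delta>"

definition equivariant_evolution ::
  "'n tanner \<Rightarrow> ('n \<Rightarrow> 'n) \<Rightarrow> (nat \<Rightarrow> 'n \<Rightarrow> 'n \<Rightarrow> 'm) \<Rightarrow> (nat \<Rightarrow> 'n \<Rightarrow> 'n \<Rightarrow> 'm) \<Rightarrow>
   (nat \<Rightarrow> 'n \<Rightarrow> 'm) \<Rightarrow> bool" where
  "equivariant_evolution G \<psi> \<nu> \<mu> \<delta> \<longleftrightarrow>
     (\<forall>l. \<forall>(v, c)\<in>edges G. \<nu> l v c = \<nu> l (\<psi> v) (\<psi> c) \<and> \<mu> l c v = \<mu> l (\<psi> c) (\<psi> v)) \<and>
     (\<forall>l. \<forall>v\<in>vnodes G. \<delta> l v = \<delta> l (\<psi> v))"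

end

theory Submission
  imports Defs
begin

text \<open>An automorphism carries the neighbourhood of each node bijectively onto the
  neighbourhood of its image (\<open>Aut_image_checks_of\<close>, \<open>Aut_image_vars_of\<close>),
  and injectivity lets this survive the removal of the recipient of the message. If the incoming
  messages are already invariant, the multisets collected at a node and at its image therefore
  coincide (\<open>image_mset_mset_set_transport\<close>). The remaining inputs (prior, syndrome
  entry, boundary messages, local rule) also agree at both places, so the outgoing messages agree.
  Induction on the iteration spreads this from the initial messages to all later ones. The argument
  uses only that the rules are constant along orbits of \<open>\<psi>\<close>, so it is carried out
  once for arbitrary rule families in \<open>equivariant_evolution_if_rules_invariant\<close>; the
  three decoders are instances.\<close>

text \<open>Injectivity keeps multiplicities: no two indices merge under \<open>\<psi>\<close>. For
  infinite \<open>A\<close> both sides are empty, as \<open>mset_set\<close> is empty on infinite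
  sets.\<close>

lemma image_mset_mset_set_transport:
  assumes "inj_on \<psi> A" "\<And>x. x \<in> A \<Longrightarrow> f x = g (\<psi> x)"
  shows "image_mset f (mset_set A) = image_mset g (mset_set (\<psi> ` A))"
proof -
  have "image_mset f (mset_set A) = image_mset (g \<circ> \<psi>) (mset_set A)"
    using assms(2) by (cases "finite A") (auto intro!: image_mset_cong)
  then show ?thesis
    using assms(1) by (simp add: image_mset_mset_set[symmetric] multiset.map_comp)
qed

lemma Aut_image_checks_of:
  assumes "tanner_graph G" "\<psi> \<in> Aut G" "v \<in> vnodes G"
  shows "\<psi> ` checks_of G v = checks_of G (\<psi> v)"
proof
  show "\<psi> ` checks_of G v \<subseteq> checks_of G (\<psi> v)"
    using assms by (auto simp: tanner_graph_def Aut_def checks_of_def)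
  \<comment> \<open>This inclusion needs surjectivity on check nodes to find a preimage, and the
    reflection of edges by \<open>\<psi>\<close> to see that the preimage is adjacent to
    \<open>v\<close>.\<close>
  show "checks_of G (\<psi> v) \<subseteq> \<psi> ` checks_of G v"
  proof
    fix d assume d: "d \<in> checks_of G (\<psi> v)"
    have "checks_of G (\<psi> v) \<subseteq> cnodes G" "cnodes G = \<psi> ` cnodes G"
      using assms(1,2) by (auto simp: tanner_graph_def Aut_def checks_of_def)
    with d obtain c where "c \<in> cnodes G" "d = \<psi> c" by blast
    then show "d \<in> \<psi> ` checks_of G v"
      using d assms(2,3) by (auto simp: Aut_def checks_of_def)
  qed
qed

lemma Aut_image_vars_of:
  assumes "tanner_graph G" "\<psi> \<in> Aut G" "c \<in> cnodes G"
  shows "\<psi> ` vars_of G c = vars_of G (\<psi> c)"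
proof
  show "\<psi> ` vars_of G c \<subseteq> vars_of G (\<psi> c)"
    using assms by (auto simp: tanner_graph_def Aut_def vars_of_def)
  show "vars_of G (\<psi> c) \<subseteq> \<psi> ` vars_of G c"
  proof
    fix w assume w: "w \<in> vars_of G (\<psi> c)"
    have "vars_of G (\<psi> c) \<subseteq> vnodes G" "vnodes G = \<psi> ` vnodes G"
      using assms(1,2) by (auto simp: tanner_graph_def Aut_def vars_of_def)
    with w obtain v where "v \<in> vnodes G" "w = \<psi> v" by blast
    then show "w \<in> \<psi> ` vars_of G c"
      using w assms(2,3) by (auto simp: Aut_def vars_of_def)
  qed
qed

text \<open>The common core: \<open>R\<close> assigns a rule to each edge and \<open>D\<close> a
  decision rule to each variable node. Decoder labelings enter only through the invariance of these
  two families.\<close>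

lemma equivariant_evolution_if_rules_invariant:
  assumes G: "tanner_graph G"
    and \<psi>: "\<psi> \<in> Aut G"
    and s: "preserves \<psi> (cnodes G) s"
    and init: "\<forall>(v, c)\<in>edges G. \<nu> 0 v c = \<nu> 0 (\<psi> v) (\<psi> c)"
    and b: "\<forall>l. \<forall>u\<in>vnodes G \<union> cnodes G. b l u = b l (\<psi> u)"
    and R: "\<And>v c. (v, c) \<in> edges G \<Longrightarrow> R (\<psi> v) (\<psi> c) = R v c"
    and D: "\<And>v. v \<in> vnodes G \<Longrightarrow> D (\<psi> v) = D v"
    and vu: "var_updates G R lam b \<nu> \<mu>"
    and cu: "check_updates G \<Psi> s b \<nu> \<mu>"
    and dec: "decisions G D lam b \<mu> \<delta>"
  shows "equivariant_evolution G \<psi> \<nu> \<mu> \<delta>"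
proof -
  have inj: "inj_on \<psi> (vnodes G \<union> cnodes G)"
    using \<psi> by (simp add: Aut_def bij_betw_def)
  have nodes: "v \<in> vnodes G" "c \<in> cnodes G" if "(v, c) \<in> edges G" for v c
    using G that by (auto simp: tanner_graph_def)
  have edge: "(\<psi> v, \<psi> c) \<in> edges G" if "(v, c) \<in> edges G" for v c
    using \<psi> nodes[OF that] that by (auto simp: Aut_def)
  have checks_sub: "checks_of G v \<subseteq> vnodes G \<union> cnodes G" for v
    using nodes by (auto simp: checks_of_def)
  have vars_sub: "vars_of G c \<subseteq> vnodes G \<union> cnodes G" for c
    using nodes by (auto simp: vars_of_def)
  \<comment> \<open>Images commute with set difference only because \<open>\<psi>\<close> is
    injective: no other neighbour may land on \<open>\<psi> c\<close>.\<close>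
  have checks: "\<psi> ` (checks_of G v - {c}) = checks_of G (\<psi> v) - {\<psi> c}"
    if "(v, c) \<in> edges G" for v c
    using inj_on_image_set_diff[OF inj, of "checks_of G v" "{c}"] checks_sub nodes[OF that]
      Aut_image_checks_of[OF G \<psi>] by auto
  have vars: "\<psi> ` (vars_of G c - {v}) = vars_of G (\<psi> c) - {\<psi> v}"
    if "(v, c) \<in> edges G" for v c
    using inj_on_image_set_diff[OF inj, of "vars_of G c" "{v}"] vars_sub nodes[OF that]
      Aut_image_vars_of[OF G \<psi>] by auto
  \<comment> \<open>Check updates read variable messages of the same iteration, so there is no index
    shift here.\<close>
  have step_check: "\<mu> l c v = \<mu> l (\<psi> c) (\<psi> v)"
    if IH: "\<And>v c. (v, c) \<in> edges G \<Longrightarrow> \<nu> l v c = \<nu> l (\<psi> v) (\<psi> c)"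
      and e: "(v, c) \<in> edges G" for l v c
  proof -
    have "image_mset (\<lambda>v'. \<nu> l v' c) (mset_set (vars_of G c - {v})) =
        image_mset (\<lambda>v'. \<nu> l v' (\<psi> c)) (mset_set (\<psi> ` (vars_of G c - {v})))"
      by (rule image_mset_mset_set_transport)
        (use vars_sub[of c] in \<open>auto intro: inj_on_subset[OF inj]\<close>,
         auto simp: vars_of_def intro: IH)
    moreover have "s (\<psi> c) = s c" "b l (\<psi> c) = b l c"
      using s b nodes[OF e] by (auto simp: preserves_def)
    \<comment> \<open>Stated for a general edge, as it is applied both to the given edge and to its
      image.\<close>
    moreover have "\<mu> l y x = \<Psi> (s y)
        (image_mset (\<lambda>v'. \<nu> l v' y) (mset_set (vars_of G y - {x})) + b l y)"
      if "(x, y) \<in> edges G" for x y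
      using cu that by (auto simp: check_updates_def)
    ultimately show ?thesis
      using e edge[OF e] vars[OF e] by simp
  qed
  \<comment> \<open>Writing the iteration as \<open>Suc l\<close> turns the index
    \<open>l - 1\<close> of the update into \<open>l\<close>; the boundary messages keep the index
    \<open>Suc l\<close> of the result.\<close>
  have step_var: "\<nu> (Suc l) v c = \<nu> (Suc l) (\<psi> v) (\<psi> c)"
    if IH: "\<And>v c. (v, c) \<in> edges G \<Longrightarrow> \<mu> l c v = \<mu> l (\<psi> c) (\<psi> v)"
      and e: "(v, c) \<in> edges G" for l v c
  proof -
    have "image_mset (\<lambda>c'. \<mu> l c' v) (mset_set (checks_of G v - {c})) =
        image_mset (\<lambda>c'. \<mu> l c' (\<psi> v)) (mset_set (\<psi> ` (checks_of G v - {c})))"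
      by (rule image_mset_mset_set_transport)
        (use checks_sub[of v] in \<open>auto intro: inj_on_subset[OF inj]\<close>,
         auto simp: checks_of_def intro: IH)
    moreover have "b (Suc l) (\<psi> v) = b (Suc l) v"
      using b nodes[OF e] by auto
    moreover have "\<nu> (Suc l) x y = R x y lam
        (image_mset (\<lambda>c'. \<mu> l c' x) (mset_set (checks_of G x - {y})) + b (Suc l) x)"
      if "(x, y) \<in> edges G" for x y
      using vu[unfolded var_updates_def, rule_format, of "Suc l" "(x, y)"] that by simp
    ultimately show ?thesis
      using e edge[OF e] checks[OF e] R[OF e] by simp
  qed
  \<comment> \<open>Induction on the variable messages alone suffices: a full round from
    \<open>\<nu> l\<close> through \<open>\<mu> l\<close> to \<open>\<nu> (Suc l)\<close> composes
    the two steps.\<close>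
  have \<nu>: "\<nu> l v c = \<nu> l (\<psi> v) (\<psi> c)" if "(v, c) \<in> edges G" for l v c
    using that
  proof (induction l arbitrary: v c)
    case 0
    then show ?case using init by auto
  next
    case (Suc l)
    show ?case by (rule step_var[OF step_check[OF Suc.IH] Suc.prems])
  qed
  have \<mu>: "\<mu> l c v = \<mu> l (\<psi> c) (\<psi> v)" if "(v, c) \<in> edges G" for l v c
    by (rule step_check[OF \<nu> that])
  \<comment> \<open>Decisions feed nothing back and use the whole neighbourhood, so neither
    induction nor set difference is involved.\<close>
  have \<delta>: "\<delta> l v = \<delta> l (\<psi> v)" if v: "v \<in> vnodes G" for l v
  proof -
    have "image_mset (\<lambda>c. \<mu> l c v) (mset_set (checks_of G v)) =
        image_mset (\<lambda>c. \<mu> l c (\<psi> v)) (mset_set (\<psi> ` checks_of G v))"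
      by (rule image_mset_mset_set_transport)
        (use checks_sub[of v] in \<open>auto intro: inj_on_subset[OF inj]\<close>,
         auto simp: checks_of_def intro: \<mu>)
    moreover have "\<psi> v \<in> vnodes G"
      using \<psi> v by (auto simp: Aut_def)
    moreover have "b l (\<psi> v) = b l v"
      using b v by auto
    ultimately show ?thesis
      using dec v D[OF v] Aut_image_checks_of[OF G \<psi> v] by (simp add: decisions_def)
  qed
  show ?thesis
    using \<nu> \<mu> \<delta> by (auto simp: equivariant_evolution_def)
qed

theorem lemma1:
  fixes G H :: "'n tanner"
    and \<psi> :: "'n \<Rightarrow> 'n"
    and s :: "'n \<Rightarrow> 's"
    and lam :: 'p
    and \<Phi> \<Phi>dec :: "('p, 'm) rule"
    and \<Phi>s :: "nat \<Rightarrow> ('p, 'm) rule"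
    and \<Psi> :: "('s, 'm) rule"
    and K :: nat
    and \<chi>V :: "'n \<Rightarrow> nat"
    and \<chi>E :: "'n \<times> 'n \<Rightarrow> nat"
    and b :: "nat \<Rightarrow> 'n \<Rightarrow> 'm multiset"
    and \<nu> \<mu> :: "nat \<Rightarrow> 'n \<Rightarrow> 'n \<Rightarrow> 'm"
    and \<delta> :: "nat \<Rightarrow> 'n \<Rightarrow> 'm"
  assumes "tanner_graph H"
    and "tanner_graph G"
    and "induced_tanner_subgraph G H"
    and "\<psi> \<in> Aut_C G s"
    and "\<forall>(v, c)\<in>edges G. \<nu> 0 v c = \<nu> 0 (\<psi> v) (\<psi> c)"
    and "\<forall>l. \<forall>u\<in>vnodes G \<union> cnodes G. b l u = b l (\<psi> u)"
  shows "(isotropic_decoder G \<Phi> \<Psi> lam s b \<nu> \<mu> \<delta> \<longrightarrow> equivariant_evolution G \<psi> \<nu> \<mu> \<delta>) \<and>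
         (variable_anisotropic_decoder G K \<chi>V \<Phi>s \<Psi> lam s b \<nu> \<mu> \<delta> \<and> \<psi> \<in> Aut_CV G s \<chi>V
            \<longrightarrow> equivariant_evolution G \<psi> \<nu> \<mu> \<delta>) \<and>
         (edge_anisotropic_decoder G K \<chi>E \<Phi>s \<Phi>dec \<Psi> lam s b \<nu> \<mu> \<delta> \<and> \<psi> \<in> Aut_CE G s \<chi>E
            \<longrightarrow> equivariant_evolution G \<psi> \<nu> \<mu> \<delta>)"
proof -
  have \<psi>: "\<psi> \<in> Aut G" and s: "preserves \<psi> (cnodes G) s"
    using assms(4) by (auto simp: Aut_C_def)
  note core = equivariant_evolution_if_rules_invariant
    [where \<nu> = \<nu> and b = b, OF assms(2) \<psi> s assms(5,6)]
  show ?thesis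
  proof (intro conjI impI)
    assume "isotropic_decoder G \<Phi> \<Psi> lam s b \<nu> \<mu> \<delta>"
    then show "equivariant_evolution G \<psi> \<nu> \<mu> \<delta>"
      unfolding isotropic_decoder_def
      by (intro core[where R = "\<lambda>v c. \<Phi>" and D = "\<lambda>v. \<Phi>"]) auto
  next
    assume A: "variable_anisotropic_decoder G K \<chi>V \<Phi>s \<Psi> lam s b \<nu> \<mu> \<delta> \<and> \<psi> \<in> Aut_CV G s \<chi>V"
    then have "\<chi>V (\<psi> v) = \<chi>V v" if "v \<in> vnodes G" for v
      using that by (auto simp: Aut_CV_def preserves_def)
    \<comment> \<open>The edge rule is read off from the label of its variable endpoint, so label
      invariance on nodes has to be passed on to edges.\<close>
    moreover have "v \<in> vnodes G" if "(v, c) \<in> edges G" for v c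
      using assms(2) that by (auto simp: tanner_graph_def)
    ultimately show "equivariant_evolution G \<psi> \<nu> \<mu> \<delta>"
      using A unfolding variable_anisotropic_decoder_def
      by (intro core[where R = "\<lambda>v c. \<Phi>s (\<chi>V v)" and D = "\<lambda>v. \<Phi>s (\<chi>V v)"]) auto
  next
    assume A: "edge_anisotropic_decoder G K \<chi>E \<Phi>s \<Phi>dec \<Psi> lam s b \<nu> \<mu> \<delta> \<and> \<psi> \<in> Aut_CE G s \<chi>E"
    then have "\<chi>E (\<psi> v, \<psi> c) = \<chi>E (v, c)" if "(v, c) \<in> edges G" for v c
      using that by (auto simp: Aut_CE_def preserves_def)
    then show "equivariant_evolution G \<psi> \<nu> \<mu> \<delta>"
      using A unfolding edge_anisotropic_decoder_def
      \<comment> \<open>The decision rule is common to all variable nodes, hence trivially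
        invariant; the edge labeling matters only for \<open>R\<close>.\<close>
      by (intro core[where R = "\<lambda>v c. \<Phi>s (\<chi>E (v, c))" and D = "\<lambda>v. \<Phi>dec"]) auto
  qed
qed

end
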